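(* Let $\{f_n\}_{n\ge 1}$ and $f$ be probability density functions on $\mathbb{R}^d$ such that $f_n \to f$ in Lebesgue measure and $H(f)$ is finite. If the family of entropy integrands $g_n = f_n\,\lvert \log f_n\rvert$ ($n\ge 1$) is uniformly integrable and tight, then $H(f_n) \to H(f)$.
   Context: $\lambda$ is Lebesgue measure on $\mathbb{R}^d$. A probability density function (pdf) on $\mathbb{R}^d$ is a measurable $f:\mathbb{R}^d\to[0,\infty)$ with $\int f\,dx=1$. The differential entropy is $H(f) = -\int_{\mathbb{R}^d} f\log f\,dx$, with natural logarithm and the convention $0\log 0=0$; $f\lvert\log f\rvert$ is likewise $0$ where $f=0$. "$H(f)$ finite" means $f\log f\in L^1(\mathbb{R}^d)$. A family $\{g_n\}$ of integrable functions on a measure space $(\Omega,\mathcal{F},\mu)$ is uniformly integrable and tight if: (A) $\sup_n\int\lvert g_n\rvert\,d\mu<\infty$; (B) for every $\varepsilon>0$ there is $M>0$ with $\sup_n\int_{\{\lvert g_n\rvert>M\}}\lvert g_n\rvert\,d\mu<\varepsilon$; (C) for every $\varepsilon>0$ there is a measurable $K\subset\Omega$ with $\mu(K)<\infty$ and $\sup_n\int_{\Omega\setminus K}\lvert g_n\rvert\,d\mu<\varepsilon$. Here it is applied with $(\Omega,\mu)=(\mathbb{R}^d,\lambda)$. *)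

theory Defs
  imports "HOL-Analysis.Analysis"
begin

definition is_pdf :: "('a::euclidean_space \<Rightarrow> real) \<Rightarrow> bool" where
  "is_pdf f \<longleftrightarrow>
     f \<in> borel_measurable lebesgue \<and> (\<forall>x. 0 \<le> f x) \<and>
     (\<integral>\<^sup>+ x. ennreal (f x) \<partial>lebesgue) = 1"

(* In HOL, ln 0 is some real number, so f x * ln (f x) = 0 where f x = 0:
   this is the convention 0 log 0 = 0.  The Bochner integral is 0 for a
   non-integrable integrand, so the value is meaningful only under finite_entropy. *)

definition finite_entropy :: "('a::euclidean_space \<Rightarrow> real) \<Rightarrow> bool" where
  "finite_entropy f \<longleftrightarrow> integrable lebesgue (\<lambda>x. f x * ln (f x))"

definition differential_entropy :: "('a::euclidean_space \<Rightarrow> real) \<Rightarrow> real" where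
  "differential_entropy f = - (\<integral>x. f x * ln (f x) \<partial>lebesgue)"

(* emeasure rather than measure, since measure would assign 0 to sets of infinite measure *)
definition tendsto_in_measure :: "'b measure \<Rightarrow> (nat \<Rightarrow> 'b \<Rightarrow> real) \<Rightarrow> ('b \<Rightarrow> real) \<Rightarrow> bool" where
  "tendsto_in_measure M f g \<longleftrightarrow>
     (\<forall>\<epsilon>>0. (\<lambda>n. emeasure M {x \<in> space M. \<bar>f n x - g x\<bar> > \<epsilon>}) \<longlonglongrightarrow> 0)"

definition unif_integrable_tight :: "'b measure \<Rightarrow> 'i set \<Rightarrow> ('i \<Rightarrow> 'b \<Rightarrow> real) \<Rightarrow> bool" where
  "unif_integrable_tight M I g \<longleftrightarrow>
     (\<forall>n\<in>I. integrable M (g n)) \<and>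
     (SUP n\<in>I. \<integral>\<^sup>+ x. ennreal \<bar>g n x\<bar> \<partial>M) < \<infinity> \<and>
     (\<forall>\<epsilon>>0. \<exists>c>0.
        (SUP n\<in>I. \<integral>\<^sup>+ x\<in>{x \<in> space M. \<bar>g n x\<bar> > c}. ennreal \<bar>g n x\<bar> \<partial>M) < ennreal \<epsilon>) \<and>
     (\<forall>\<epsilon>>0. \<exists>K\<in>sets M. emeasure M K < \<infinity> \<and>
        (SUP n\<in>I. \<integral>\<^sup>+ x\<in>space M - K. ennreal \<bar>g n x\<bar> \<partial>M) < ennreal \<epsilon>)"

end

theory Submission
  imports Defs "HOL-Real_Asymp.Real_Asymp"
begin

text \<open>
  Along a subsequence that converges almost everywhere, the integrands \<open>f\<^sub>n log f\<^sub>n\<close> converge almost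
  everywhere because \<open>t log t\<close> is continuous on \<open>[0, \<infinity>)\<close>, so Vitali's theorem applies.
  Every subsequence contains such a further subsequence, hence the whole sequence of entropies converges.
  For Vitali's theorem, let \<open>\<phi>\<^sub>n\<close> be the integrand clamped to \<open>[-c, c]\<close> and restricted to a set of
  finite measure. Its integrals converge by dominated convergence, uniform integrability and tightness make
  the error of this replacement small uniformly in \<open>n\<close>, and by Fatou the limit inherits the same error bound.
\<close>

text \<open>Only the endpoint 0 needs an argument: there the right-hand limit of
  \<open>x * ln x\<close> is 0, which agrees with the value \<open>0 * ln 0 = 0\<close>.\<close>

lemma continuous_on_x_ln_x: "continuous_on {0..} (\<lambda>x::real. x * ln x)"
  unfolding continuous_on_def
proof
  fix x :: real
  assume x: "x \<in> {0..}"
  show "((\<lambda>x. x * ln x) \<longlongrightarrow> x * ln x) (at x within {0..})"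
  proof (cases "x = 0")
    case True
    have "((\<lambda>x::real. x * ln x) \<longlongrightarrow> 0) (at_right 0)"
      by real_asymp
    then have "((\<lambda>x::real. x * ln x) \<longlongrightarrow> 0) (at 0 within {0..})"
      by (simp add: at_within_Ici_at_right)
    with True show ?thesis by simp
  next
    case False
    with x show ?thesis by (intro tendsto_intros) auto
  qed
qed

lemma tendsto_in_measure_subseq:
  assumes "tendsto_in_measure M f g" "strict_mono r"
  shows "tendsto_in_measure M (\<lambda>n. f (r n)) g"
  using assms LIMSEQ_subseq_LIMSEQ[OF _ assms(2)]
  unfolding tendsto_in_measure_def comp_def by blast

text \<open>Choose \<open>r\<close> so fast that the set where \<open>f (r k)\<close> deviates from
  \<open>g\<close> by more than \<open>(1/2)^k\<close> has measure below \<open>(1/2)^k\<close>.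
  These measures are summable, so by Borel-Cantelli almost every point lies in only finitely many of
  the sets, and from then on its error is at most \<open>(1/2)^k\<close>.\<close>

lemma tendsto_in_measure_AE_subseq:
  fixes f :: "nat \<Rightarrow> 'b \<Rightarrow> real"
  assumes [measurable]: "\<And>n. f n \<in> borel_measurable M" "g \<in> borel_measurable M"
    and lim: "tendsto_in_measure M f g"
  shows "\<exists>r::nat\<Rightarrow>nat. strict_mono r \<and> (AE x in M. (\<lambda>n. f (r n) x) \<longlonglongrightarrow> g x)"
proof -
  define A where "A k n = {x \<in> space M. \<bar>f n x - g x\<bar> > (1/2)^k}" for k n :: nat
  have [measurable]: "A k n \<in> sets M" for k n
    unfolding A_def by measurable
  have "\<exists>n>m. emeasure M (A k n) < ennreal ((1/2)^k)" for m k
  proof -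
    have "(\<lambda>n. emeasure M (A k n)) \<longlonglongrightarrow> 0"
      using lim unfolding tendsto_in_measure_def A_def by simp
    then have "eventually (\<lambda>n. emeasure M (A k n) < ennreal ((1/2)^k)) sequentially"
      by (rule order_tendstoD) simp
    then have "eventually (\<lambda>n. n > m \<and> emeasure M (A k n) < ennreal ((1/2)^k)) sequentially"
      using eventually_gt_at_top[of m] by eventually_elim simp
    then show ?thesis
      using eventually_happens' sequentially_bot by blast
  qed
  then have "\<exists>r. \<forall>k. emeasure M (A k (r k)) < ennreal ((1/2)^k) \<and> r k < r (Suc k)"
    by (intro dependent_nat_choice) (blast+)
  then obtain r :: "nat \<Rightarrow> nat"
    where small: "\<And>k. emeasure M (A k (r k)) < ennreal ((1/2)^k)" and mono: "strict_mono r"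
    by (auto simp: strict_mono_Suc_iff)
  \<comment> \<open>Since \<open>measure\<close> is 0 on sets of infinite measure, summability of
    the \<open>measure\<close> values is informative only together with this finiteness.\<close>
  have fin: "emeasure M (A k (r k)) < \<infinity>" for k
    using small[of k] by (rule order.strict_trans) simp
  have "measure M (A k (r k)) \<le> (1/2)^k" for k
    unfolding measure_def using less_imp_le[OF small[of k]] by (simp add: enn2real_leI)
  then have "summable (\<lambda>k. measure M (A k (r k)))"
    by (intro summable_comparison_test'[OF summable_geometric[of "1/2::real"]]) auto
  then have "AE x in M. eventually (\<lambda>k. x \<in> space M - A k (r k)) sequentially"
    using fin by (intro borel_cantelli_AE1) auto
  then have "AE x in M. (\<lambda>n. f (r n) x) \<longlonglongrightarrow> g x"
  proof (rule AE_mp, intro AE_I2 impI)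
    fix x
    assume "eventually (\<lambda>k. x \<in> space M - A k (r k)) sequentially"
    then have "eventually (\<lambda>k. norm (f (r k) x - g x) \<le> (1/2)^k) sequentially"
      by eventually_elim (auto simp: A_def)
    then have "(\<lambda>k. f (r k) x - g x) \<longlonglongrightarrow> 0"
      by (rule Lim_null_comparison) (intro LIMSEQ_realpow_zero, auto)
    then show "(\<lambda>n. f (r n) x) \<longlonglongrightarrow> g x"
      by (simp add: LIM_zero_iff)
  qed
  with mono show ?thesis by blast
qed

text \<open>The bounds see a family only through its absolute values. One application therefore both
  passes to a subsequence and replaces \<open>f * \<bar>ln f\<bar>\<close> by the signed entropy
  integrand.\<close>

lemma unif_integrable_tight_reindex:
  fixes g :: "'i \<Rightarrow> 'b \<Rightarrow> real" and h :: "'j \<Rightarrow> 'b \<Rightarrow> real"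
  assumes g: "unif_integrable_tight M I g"
    and r: "\<And>j. j \<in> J \<Longrightarrow> r j \<in> I"
    and h: "\<And>j. j \<in> J \<Longrightarrow> h j \<in> borel_measurable M"
    and abs_eq: "\<And>j x. j \<in> J \<Longrightarrow> \<bar>h j x\<bar> = \<bar>g (r j) x\<bar>"
  shows "unif_integrable_tight M J h"
proof -
  \<comment> \<open>\<open>F\<close> will be, in turn, the integral over the whole space, above the
    level \<open>c\<close>, and outside \<open>K\<close>.\<close>
  have SUP_le: "(SUP j\<in>J. F (\<lambda>x. \<bar>h j x\<bar>)) \<le> (SUP i\<in>I. F (\<lambda>x. \<bar>g i x\<bar>))"
    for F :: "('b \<Rightarrow> real) \<Rightarrow> ennreal"
    by (rule SUP_mono) (use r abs_eq in auto)
  have "integrable M (h j)" if "j \<in> J" for j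
    using g r[OF that] h[OF that] abs_eq[OF that] unfolding unif_integrable_tight_def
    by (intro Bochner_Integration.integrable_bound[of M "g (r j)" "h j"]) auto
  moreover have "(SUP j\<in>J. \<integral>\<^sup>+ x. ennreal \<bar>h j x\<bar> \<partial>M) < \<infinity>"
    using g unfolding unif_integrable_tight_def
    by (intro order.strict_trans1[OF SUP_le[of "\<lambda>u. \<integral>\<^sup>+ x. ennreal (u x) \<partial>M"]]) simp
  moreover have "\<exists>c>0. (SUP j\<in>J. \<integral>\<^sup>+ x\<in>{x \<in> space M. \<bar>h j x\<bar> > c}. ennreal \<bar>h j x\<bar> \<partial>M) < ennreal \<epsilon>"
    if \<epsilon>: "\<epsilon> > 0" for \<epsilon>
  proof -
    obtain c where "c > 0"
      and c: "(SUP i\<in>I. \<integral>\<^sup>+ x\<in>{x \<in> space M. \<bar>g i x\<bar> > c}. ennreal \<bar>g i x\<bar> \<partial>M) < ennreal \<epsilon>"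
      using g \<epsilon> unfolding unif_integrable_tight_def by blast
    then show ?thesis
      using order.strict_trans1[OF SUP_le[of "\<lambda>u. \<integral>\<^sup>+ x\<in>{x \<in> space M. u x > c}. ennreal (u x) \<partial>M"] c]
      by blast
  qed
  moreover have "\<exists>K\<in>sets M. emeasure M K < \<infinity> \<and>
      (SUP j\<in>J. \<integral>\<^sup>+ x\<in>space M - K. ennreal \<bar>h j x\<bar> \<partial>M) < ennreal \<epsilon>" if \<epsilon>: "\<epsilon> > 0" for \<epsilon>
  proof -
    obtain K where "K \<in> sets M" "emeasure M K < \<infinity>"
      and K: "(SUP i\<in>I. \<integral>\<^sup>+ x\<in>space M - K. ennreal \<bar>g i x\<bar> \<partial>M) < ennreal \<epsilon>"
      using g \<epsilon> unfolding unif_integrable_tight_def by blast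
    then show ?thesis
      using order.strict_trans1[OF SUP_le[of "\<lambda>u. \<integral>\<^sup>+ x\<in>space M - K. ennreal (u x) \<partial>M"] K]
      by blast
  qed
  ultimately show ?thesis
    unfolding unif_integrable_tight_def by blast
qed

theorem Vitali_convergence:
  fixes h :: "nat \<Rightarrow> 'b \<Rightarrow> real"
  assumes uit: "unif_integrable_tight M UNIV h"
    and int: "integrable M g"
    and lim: "AE x in M. (\<lambda>n. h n x) \<longlonglongrightarrow> g x"
  shows "(\<lambda>n. \<integral>x. h n x \<partial>M) \<longlonglongrightarrow> (\<integral>x. g x \<partial>M)"
proof (rule LIMSEQ_I)
  fix e :: real
  assume "e > 0"
  \<comment> \<open>Truncation costs at most \<open>2 * \<epsilon>\<close> for \<open>h n\<close>
    and \<open>2 * \<epsilon>\<close> for \<open>g\<close>; the truncated integrals differ by less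
    than \<open>\<epsilon>\<close>.\<close>
  define \<epsilon> where "\<epsilon> = e / 5"
  have \<epsilon>: "\<epsilon> > 0" using \<open>e > 0\<close> by (simp add: \<epsilon>_def)
  have int_h: "integrable M (h n)" for n
    using uit unfolding unif_integrable_tight_def by blast
  have [measurable]: "h n \<in> borel_measurable M" "g \<in> borel_measurable M" for n
    using int_h int by (auto intro: borel_measurable_integrable)
  obtain c where c: "c > 0"
    and c_sup: "(SUP n. \<integral>\<^sup>+ x\<in>{x \<in> space M. \<bar>h n x\<bar> > c}. ennreal \<bar>h n x\<bar> \<partial>M) < ennreal \<epsilon>"
    using uit \<epsilon> unfolding unif_integrable_tight_def by blast
  obtain K where [measurable]: "K \<in> sets M" and K: "emeasure M K < \<infinity>"
    and K_sup: "(SUP n. \<integral>\<^sup>+ x\<in>space M - K. ennreal \<bar>h n x\<bar> \<partial>M) < ennreal \<epsilon>"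
    using uit \<epsilon> unfolding unif_integrable_tight_def by blast
  \<comment> \<open>Clamping is continuous in the value \<open>u x\<close>, so pointwise limits pass
    through \<open>T\<close>. Setting \<open>u\<close> to 0 where its absolute value exceeds
    \<open>c\<close> would jump at that level.\<close>
  define T where "T u x = indicat_real K x * max (-c) (min c (u x))" for u :: "'b \<Rightarrow> real" and x
  have T_bound: "norm (T u x) \<le> c * indicat_real K x" for u x
    using c by (auto simp: T_def split: split_indicator)
  have [measurable]: "T u \<in> borel_measurable M" if "u \<in> borel_measurable M" for u
    using that unfolding T_def by measurable
  have int_K: "integrable M (\<lambda>x. c * indicat_real K x)"
    using K by simp
  have int_T: "integrable M (T u)" if [measurable]: "u \<in> borel_measurable M" for u
    using T_bound[of u] c by (intro Bochner_Integration.integrable_bound[OF int_K]) auto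
  have T_lim: "(\<lambda>n. \<integral>x. T (h n) x \<partial>M) \<longlonglongrightarrow> (\<integral>x. T g x \<partial>M)"
  proof (rule integral_dominated_convergence[OF _ _ int_K])
    show "AE x in M. (\<lambda>n. T (h n) x) \<longlonglongrightarrow> T g x"
      using lim unfolding T_def by eventually_elim (intro tendsto_intros)
  qed (use T_bound in auto)
  have err_h: "(\<integral>\<^sup>+ x. ennreal \<bar>h n x - T (h n) x\<bar> \<partial>M) \<le> ennreal (2 * \<epsilon>)" for n
  proof -
    have "(\<integral>\<^sup>+ x. ennreal \<bar>h n x - T (h n) x\<bar> \<partial>M) \<le>
      (\<integral>\<^sup>+ x. ennreal \<bar>h n x\<bar> * indicator {x \<in> space M. \<bar>h n x\<bar> > c} x +
        ennreal \<bar>h n x\<bar> * indicator (space M - K) x \<partial>M)"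
      \<comment> \<open>Pointwise, the difference vanishes on \<open>K\<close> where
        \<open>\<bar>h n x\<bar> \<le> c\<close>; elsewhere it is at most
        \<open>\<bar>h n x\<bar>\<close>, and at least one of the two indicators is 1.\<close>
      using c by (intro nn_integral_mono)
        (auto simp: T_def split: split_indicator simp flip: ennreal_plus intro!: ennreal_leI)
    also have "\<dots> = (\<integral>\<^sup>+ x\<in>{x \<in> space M. \<bar>h n x\<bar> > c}. ennreal \<bar>h n x\<bar> \<partial>M) +
        (\<integral>\<^sup>+ x\<in>space M - K. ennreal \<bar>h n x\<bar> \<partial>M)"
      by (intro nn_integral_add) auto
    also have "\<dots> \<le> ennreal \<epsilon> + ennreal \<epsilon>"
      by (intro add_mono SUP_upper[THEN order_trans, OF _ less_imp_le[OF c_sup]]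
            SUP_upper[THEN order_trans, OF _ less_imp_le[OF K_sup]]) auto
    also have "\<dots> = ennreal (2 * \<epsilon>)"
      using \<epsilon> by (simp flip: ennreal_plus)
    finally show ?thesis .
  qed
  have err_g: "(\<integral>\<^sup>+ x. ennreal \<bar>g x - T g x\<bar> \<partial>M) \<le> ennreal (2 * \<epsilon>)"
  proof -
    \<comment> \<open>Writing the limit as a liminf brings the integral into the form required by
      Fatou's lemma.\<close>
    have "AE x in M. ennreal \<bar>g x - T g x\<bar> = liminf (\<lambda>n. ennreal \<bar>h n x - T (h n) x\<bar>)"
      using lim
    proof eventually_elim
      case (elim x)
      then have "(\<lambda>n. ennreal \<bar>h n x - T (h n) x\<bar>) \<longlonglongrightarrow> ennreal \<bar>g x - T g x\<bar>"
        unfolding T_def by (intro tendsto_intros tendsto_ennrealI)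
      then show ?case
        by (intro lim_imp_Liminf[symmetric]) auto
    qed
    then have "(\<integral>\<^sup>+ x. ennreal \<bar>g x - T g x\<bar> \<partial>M) =
        (\<integral>\<^sup>+ x. liminf (\<lambda>n. ennreal \<bar>h n x - T (h n) x\<bar>) \<partial>M)"
      by (rule nn_integral_cong_AE)
    also have "\<dots> \<le> liminf (\<lambda>n. \<integral>\<^sup>+ x. ennreal \<bar>h n x - T (h n) x\<bar> \<partial>M)"
      by (rule nn_integral_liminf) measurable
    also have "\<dots> \<le> ennreal (2 * \<epsilon>)"
      using err_h by (intro Liminf_le) auto
    finally show ?thesis .
  qed
  have diff_le: "\<bar>(\<integral>x. u x \<partial>M) - (\<integral>x. T u x \<partial>M)\<bar> \<le> 2 * \<epsilon>"
    if u: "integrable M u" and err: "(\<integral>\<^sup>+ x. ennreal \<bar>u x - T u x\<bar> \<partial>M) \<le> ennreal (2 * \<epsilon>)" for u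
  proof -
    have int_Tu: "integrable M (T u)" using u by (intro int_T) auto
    have "ennreal \<bar>\<integral>x. u x - T u x \<partial>M\<bar> \<le> (\<integral>\<^sup>+ x. ennreal \<bar>u x - T u x\<bar> \<partial>M)"
      using integral_norm_bound_ennreal[of M "\<lambda>x. u x - T u x"] u int_Tu by simp
    with err have "ennreal \<bar>\<integral>x. u x - T u x \<partial>M\<bar> \<le> ennreal (2 * \<epsilon>)"
      by (rule order_trans[rotated])
    then show ?thesis
      using \<epsilon> u int_Tu by simp
  qed
  obtain N where N: "\<And>n. n \<ge> N \<Longrightarrow> \<bar>(\<integral>x. T (h n) x \<partial>M) - (\<integral>x. T g x \<partial>M)\<bar> < \<epsilon>"
    using LIMSEQ_D[OF T_lim \<epsilon>] by auto
  have "norm ((\<integral>x. h n x \<partial>M) - (\<integral>x. g x \<partial>M)) < e" if "n \<ge> N" for n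
    using N[OF that] diff_le[OF int_h[of n] err_h[of n]] diff_le[OF int err_g]
    unfolding \<epsilon>_def real_norm_def by linarith
  then show "\<exists>N. \<forall>n\<ge>N. norm ((\<integral>x. h n x \<partial>M) - (\<integral>x. g x \<partial>M)) < e"
    by blast
qed

text \<open>If \<open>X\<close> failed to converge, some subsequence would stay outside an open
  neighbourhood of \<open>L\<close>, and no further subsequence of it could converge to
  \<open>L\<close>.\<close>

lemma LIMSEQ_if_subseq_has_LIMSEQ_subseq:
  fixes X :: "nat \<Rightarrow> 'b::topological_space"
  assumes "\<And>r::nat\<Rightarrow>nat. strict_mono r \<Longrightarrow> \<exists>s::nat\<Rightarrow>nat. strict_mono s \<and> (\<lambda>n. X (r (s n))) \<longlonglongrightarrow> L"
  shows "X \<longlonglongrightarrow> L"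
proof (rule topological_tendstoI, rule ccontr)
  fix S
  assume S: "open S" "L \<in> S" and "\<not> eventually (\<lambda>n. X n \<in> S) sequentially"
  then obtain r :: "nat \<Rightarrow> nat" where r: "strict_mono r" "\<And>n. X (r n) \<notin> S"
    using not_eventually_sequentiallyD by blast
  with assms obtain s :: "nat \<Rightarrow> nat" where "(\<lambda>n. X (r (s n))) \<longlonglongrightarrow> L"
    by blast
  from topological_tendstoD[OF this S] r(2) show False
    by simp
qed

theorem lemma5:
  fixes f :: "nat \<Rightarrow> 'a::euclidean_space \<Rightarrow> real"
    and f_lim :: "'a \<Rightarrow> real"
  assumes "\<And>n. n \<ge> 1 \<Longrightarrow> is_pdf (f n)"
    and "is_pdf f_lim"
    and "tendsto_in_measure lebesgue f f_lim"
    and "finite_entropy f_lim"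
    and "unif_integrable_tight lebesgue {1..} (\<lambda>n x. f n x * \<bar>ln (f n x)\<bar>)"
  shows "(\<lambda>n. differential_entropy (f n)) \<longlonglongrightarrow> differential_entropy f_lim"
proof (rule LIMSEQ_imp_Suc, rule LIMSEQ_if_subseq_has_LIMSEQ_subseq)
  \<comment> \<open>The hypotheses speak of indices from 1 on, and \<open>f 0\<close> is arbitrary;
    hence the shift to \<open>Suc\<close>, under which every term is a density.\<close>
  fix r :: "nat \<Rightarrow> nat"
  assume r: "strict_mono r"
  have meas[measurable]: "f (Suc n) \<in> borel_measurable lebesgue" "f_lim \<in> borel_measurable lebesgue"
    and nonneg: "0 \<le> f (Suc n) x" "0 \<le> f_lim x" for n x
    using assms(1)[of "Suc n"] assms(2) by (auto simp: is_pdf_def)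
  have "strict_mono (\<lambda>n. Suc (r n))"
    using r by (simp add: strict_mono_def)
  then have "tendsto_in_measure lebesgue (\<lambda>n. f (Suc (r n))) f_lim"
    by (rule tendsto_in_measure_subseq[OF assms(3)])
  then obtain s :: "nat \<Rightarrow> nat" where s: "strict_mono s"
    and AE_lim: "AE x in lebesgue. (\<lambda>n. f (Suc (r (s n))) x) \<longlonglongrightarrow> f_lim x"
    using tendsto_in_measure_AE_subseq[of "\<lambda>n. f (Suc (r n))" lebesgue f_lim] meas by blast
  have "(\<lambda>n. \<integral>x. f (Suc (r (s n))) x * ln (f (Suc (r (s n))) x) \<partial>lebesgue) \<longlonglongrightarrow>
      (\<integral>x. f_lim x * ln (f_lim x) \<partial>lebesgue)"
  proof (rule Vitali_convergence)
    show "unif_integrable_tight lebesgue UNIV (\<lambda>n x. f (Suc (r (s n))) x * ln (f (Suc (r (s n))) x))"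
      by (rule unif_integrable_tight_reindex[OF assms(5), where r = "\<lambda>n. Suc (r (s n))"])
        (auto simp: abs_mult)
    show "integrable lebesgue (\<lambda>x. f_lim x * ln (f_lim x))"
      using assms(4) by (simp add: finite_entropy_def)
    show "AE x in lebesgue. (\<lambda>n. f (Suc (r (s n))) x * ln (f (Suc (r (s n))) x))
        \<longlonglongrightarrow> f_lim x * ln (f_lim x)"
      using AE_lim
    proof eventually_elim
      case (elim x)
      show ?case
        \<comment> \<open>Continuity is available only on \<open>{0..}\<close>; nonnegativity of the
          densities keeps the terms and the limit there.\<close>
        by (rule continuous_on_tendsto_compose[OF continuous_on_x_ln_x elim]) (auto simp: nonneg)
    qed
  qed
  then have "(\<lambda>n. differential_entropy (f (Suc (r (s n))))) \<longlonglongrightarrow> differential_entropy f_lim"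
    unfolding differential_entropy_def by (rule tendsto_minus)
  with s show "\<exists>s::nat\<Rightarrow>nat. strict_mono s \<and>
      (\<lambda>n. differential_entropy (f (Suc (r (s n))))) \<longlonglongrightarrow> differential_entropy f_lim"
    by blast
qed

end
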